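(* Let $(\mathcal{G}_t)_{t\ge1}$ be a time-varying game with $N$ agents, local costs $\mathcal{C}_{i,t}(x_i,x_{-i})$ and action sets $\mathcal{X}_i$, $i=1,\ldots,N$. Suppose that for every $t$ the game $\mathcal{G}_t$ is $m_t$-strongly monotone, that for every $i$ the partial gradient $\nabla_i\mathcal{C}_{i,t}(x_i,x_{-i})$ is $L_t$-Lipschitz continuous in $x_{-i}$ for every $x_i\in\mathcal{X}_i$, that $m_t>L_t\sqrt{N-1}$, and that for every $i$ the cost $\mathcal{C}_{i,t}(x_i,x_{-i})$ is $L_0$-Lipschitz continuous in $x_{-i}$ for every $x_i\in\mathcal{X}_i$ (with $L_0$ independent of $t$). Let $x_t^*$ be the unique Nash equilibrium of $\mathcal{G}_t$, and let $(x_t)_{t\ge1}$ be generated from $x_1\in\mathcal{X}$ by the best response algorithm $$x_{i,t+1}=\operatorname*{arg\,min}_{x_i\in\mathcal{X}_i}\mathcal{C}_{i,t}(x_i,x_{-i,t}),\qquad i=1,\ldots,N,\ t\ge1.$$ Then the dynamic regret of the best response algorithm satisfies $$\mathrm{DR}_i(T)=\mathcal{O}\left(W_{i,T}+\sqrt{T\,V_T}\right),\qquad i=1,\ldots,N.$$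
   Context: There are $N$ agents indexed by $i\in\{1,\ldots,N\}$. Agent $i$ chooses an action $x_i$ in a nonempty closed convex subset $\mathcal{X}_i$ of a finite-dimensional Euclidean space. Write $\mathcal{X}=\prod_{i=1}^N\mathcal{X}_i$, $x=(x_1,\ldots,x_N)\in\mathcal{X}$, and let $x_{-i}\in\mathcal{X}_{-i}=\prod_{j\ne i}\mathcal{X}_j$ be the vector of actions of all agents other than $i$. All norms are Euclidean. At episode $t=1,2,\ldots$, in the game $\mathcal{G}_t$, agent $i$ has a cost function $\mathcal{C}_{i,t}:\mathcal{X}\to\mathbb{R}$, $\mathcal{C}_{i,t}(x)=\mathcal{C}_{i,t}(x_i,x_{-i})$, which is convex and differentiable in $x_i$ for every $x_{-i}\in\mathcal{X}_{-i}$; $\nabla_i\mathcal{C}_{i,t}$ denotes its partial gradient with respect to $x_i$. The joint action at episode $t$ is $x_t=(x_{1,t},\ldots,x_{N,t})$, and $x_{-i,t}$ denotes the actions of all agents other than $i$ at episode $t$. A Nash equilibrium of $\mathcal{G}_t$ is a point $x_t^*\in\mathcal{X}$ with $\mathcal{C}_{i,t}(x_t^* )\le\mathcal{C}_{i,t}(x_i,x_{-i,t}^* )$ for all $x_i\in\mathcal{X}_i$ and all $i$. The game $\mathcal{G}_t$ is $m_t$-strongly monotone, with $m_t>0$, if for all $x,x'\in\mathcal{X}$, $$\sum_{i=1}^N\langle\nabla_i\mathcal{C}_{i,t}(x)-\nabla_i\mathcal{C}_{i,t}(x'),x_i-x_i'\rangle\ge m_t\|x-x'\|^2.$$ A strongly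 monotone game has a unique Nash equilibrium. The maximum $\rho_m:=\max_t\left\{\frac{L_t\sqrt{N-1}}{m_t}\right\}$ over all episodes $t$ is understood to be attained, so $\rho_m<1$. The dynamic regret of agent $i$ is $$\mathrm{DR}_i(T)=\sum_{t=1}^T\Big(\mathcal{C}_{i,t}(x_t)-\min_{y_i\in\mathcal{X}_i}\mathcal{C}_{i,t}(y_i,x_{-i,t})\Big),$$ where $T$ is the total number of episodes. The equilibrium variation is $V_T=\sum_{t=1}^T\|x_t^*-x_{t+1}^*\|^2$, and the function variation is $$W_{i,T}=\sum_{t=1}^T\sup_{x\in\mathcal{X}}|\mathcal{C}_{i,t}(x)-\mathcal{C}_{i,t+1}(x)|.$$ The notation $\mathcal{O}(\cdot)$ refers to the dependence on $T$.
   Formalization: The bound O(W_{i,T} + √(T V_T)) is proved when W_{i,T} + √(T V_T) is nonzero for some T; if it vanishes for all T the literal claim fails (N=1, cost y², x_1=1 gives regret 1), and only O(1 + W_{i,T} + √(T V_T)) is proved, which holds in every case. *)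

theory Defs
  imports "HOL-Analysis.Analysis"
begin

text \<open>
  Agents are the elements of a finite type \<open>'n\<close>, so \<open>N = CARD('n)\<close>. All action sets live in one
  Euclidean space \<open>'a\<close>; agents with action spaces of different dimensions are covered by embedding
  these isometrically into a common one. For this reason (and because costs matter only on the
  joint action set) derivatives are taken within the action set, which may have empty interior, and
  the partial gradient is a relation rather than a function: see \<open>partial_gradient\<close> below.
  The norm of \<open>'a ^ 'n\<close> is the Euclidean norm of the joint action.
\<close>

definition joint_actions :: "('n \<Rightarrow> 'a set) \<Rightarrow> ('a ^ 'n) set" where
  "joint_actions A = {x. \<forall>i. x $ i \<in> A i}"

text \<open>\<open>deviate x i y\<close> is the joint action \<open>(y, x\<^sub>-\<^sub>i)\<close>.\<close>

definition deviate :: "'a ^ 'n \<Rightarrow> 'n \<Rightarrow> 'a \<Rightarrow> 'a ^ 'n" where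
  "deviate x i y = (\<chi> j. if j = i then y else x $ j)"

definition partial_gradient ::
  "('n::finite \<Rightarrow> 'a::euclidean_space set) \<Rightarrow> 'n \<Rightarrow> ('a ^ 'n \<Rightarrow> real) \<Rightarrow> ('a ^ 'n \<Rightarrow> 'a) \<Rightarrow> bool" where
  "partial_gradient A i f g \<longleftrightarrow>
     (\<forall>x\<in>joint_actions A.
        ((\<lambda>y. f (deviate x i y)) has_derivative (\<lambda>h. g x \<bullet> h)) (at (x $ i) within A i))"

definition strongly_monotone ::
  "('n::finite \<Rightarrow> 'a::euclidean_space set) \<Rightarrow> ('n \<Rightarrow> 'a ^ 'n \<Rightarrow> 'a) \<Rightarrow> real \<Rightarrow> bool" where
  "strongly_monotone A g m \<longleftrightarrow>
     m > 0 \<and>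
     (\<forall>x\<in>joint_actions A. \<forall>x'\<in>joint_actions A.
        (\<Sum>i\<in>UNIV. (g i x - g i x') \<bullet> (x $ i - x' $ i)) \<ge> m * (norm (x - x'))\<^sup>2)"

text \<open>
  Joint actions that agree in the \<open>i\<close>-th component differ only in \<open>x\<^sub>-\<^sub>i\<close>, so on each slice below the
  distance in \<open>'a ^ 'n\<close> is the Euclidean distance of the \<open>x\<^sub>-\<^sub>i\<close>.
\<close>

definition lipschitz_in_others ::
  "('n::finite \<Rightarrow> 'a::euclidean_space set) \<Rightarrow> 'n \<Rightarrow> real \<Rightarrow> ('a ^ 'n \<Rightarrow> 'b::metric_space) \<Rightarrow> bool" where
  "lipschitz_in_others A i K f \<longleftrightarrow>
     (\<forall>a\<in>A i. K-lipschitz_on {x \<in> joint_actions A. x $ i = a} f)"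

definition nash_equilibrium ::
  "('n \<Rightarrow> 'a set) \<Rightarrow> ('n \<Rightarrow> 'a ^ 'n \<Rightarrow> real) \<Rightarrow> 'a ^ 'n \<Rightarrow> bool" where
  "nash_equilibrium A c x \<longleftrightarrow>
     x \<in> joint_actions A \<and> (\<forall>i. \<forall>y\<in>A i. c i x \<le> c i (deviate x i y))"

text \<open>
  In the following, \<open>C t i\<close> is the cost of agent \<open>i\<close> in episode \<open>t\<close>; episodes start at \<open>1\<close>.
  The infimum in the regret is a minimum whenever the best responses exist.
\<close>

definition dynamic_regret ::
  "('n \<Rightarrow> 'a set) \<Rightarrow> (nat \<Rightarrow> 'n \<Rightarrow> 'a ^ 'n \<Rightarrow> real) \<Rightarrow> (nat \<Rightarrow> 'a ^ 'n) \<Rightarrow> 'n \<Rightarrow> nat \<Rightarrow> real" where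
  "dynamic_regret A C x i T =
     (\<Sum>t=1..T. C t i (x t) - (INF y\<in>A i. C t i (deviate (x t) i y)))"

definition equilibrium_variation :: "(nat \<Rightarrow> 'a::euclidean_space ^ 'n::finite) \<Rightarrow> nat \<Rightarrow> real" where
  "equilibrium_variation xs T = (\<Sum>t=1..T. (norm (xs t - xs (Suc t)))\<^sup>2)"

text \<open>The suprema may be infinite, since action sets and costs need not be bounded.\<close>

definition function_variation ::
  "('n \<Rightarrow> 'a set) \<Rightarrow> (nat \<Rightarrow> 'n \<Rightarrow> 'a ^ 'n \<Rightarrow> real) \<Rightarrow> 'n \<Rightarrow> nat \<Rightarrow> ereal" where
  "function_variation A C i T =
     (\<Sum>t=1..T. SUP x\<in>joint_actions A. ereal \<bar>C t i x - C (Suc t) i x\<bar>)"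

text \<open>
  If the rate below vanishes for all \<open>T\<close> (static cost and equilibrium), a bound \<open>O(0)\<close> would say
  that the regret is zero, which fails already for \<open>N = 1\<close>, \<open>C t i y = y\<^sup>2\<close>, \<open>x 1 = 1\<close>; in that
  case only \<open>O(1 + rate)\<close> is meaningful. Otherwise the rate is eventually bounded away from zero.
\<close>

definition regret_rate ::
  "('n::finite \<Rightarrow> 'a::euclidean_space set) \<Rightarrow> (nat \<Rightarrow> 'n \<Rightarrow> 'a ^ 'n \<Rightarrow> real) \<Rightarrow>
   (nat \<Rightarrow> 'a ^ 'n) \<Rightarrow> 'n \<Rightarrow> nat \<Rightarrow> ereal" where
  "regret_rate A C xs i T =
     function_variation A C i T + ereal (sqrt (real T * equilibrium_variation xs T))"

text \<open>
  Landau's \<open>O\<close> as \<open>T\<close> tends to infinity, for a comparison function with values in \<open>[0, \<infinity>]\<close>, which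
  the library's \<open>O\<close> for real functions does not cover.
\<close>

definition bigo_ereal :: "(nat \<Rightarrow> real) \<Rightarrow> (nat \<Rightarrow> ereal) \<Rightarrow> bool" where
  "bigo_ereal f g \<longleftrightarrow>
     (\<exists>c>0. eventually (\<lambda>T. ereal \<bar>f T\<bar> \<le> ereal c * g T) sequentially)"

end

theory Submission
  imports Defs
begin

text \<open>
  At a minimiser the partial gradient makes a nonnegative product with every feasible direction.
  Strong monotonicity, restricted to pairs of joint actions differing only in the \<open>i\<close>-th component,
  combined with these variational inequalities shows that the best response map of episode \<open>t\<close>
  contracts the distance to the equilibrium by the factor \<open>\<rho> = L\<^sub>t \<surd>(N - 1) / m\<^sub>t < 1\<close>. Hence
  the tracking errors \<open>e\<^sub>t\<close> satisfy \<open>e\<^sub>t\<^sub>+\<^sub>1 \<le> \<rho> e\<^sub>t + \<delta>\<^sub>t\<close> with \<open>\<delta>\<^sub>t\<close> the equilibrium drift,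
  so that they sum to \<open>O(1 + \<surd>(T V\<^sub>T))\<close>. The regret in episode \<open>t + 1\<close> is compared with episode \<open>t\<close>:
  there \<open>x\<^sub>i\<^sub>,\<^sub>t\<^sub>+\<^sub>1\<close> is optimal against \<open>x\<^sub>-\<^sub>i\<^sub>,\<^sub>t\<close>, so replacing the costs and then the opponents'
  actions costs at most \<open>2 w\<^sub>t + 2 L\<^sub>0 \<parallel>x\<^sub>t\<^sub>+\<^sub>1 - x\<^sub>t\<parallel>\<close>.
\<close>

section \<open>Unilateral deviations and the Euclidean norm of joint actions\<close>

lemma deviate_nth: "deviate x i y $ j = (if j = i then y else x $ j)"
  by (simp add: deviate_def)

lemma deviate_self: "deviate x i (x $ i) = x"
  by (simp add: vec_eq_iff deviate_nth)

lemma deviate_deviate: "deviate (deviate x i y) i z = deviate x i z"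
  by (simp add: vec_eq_iff deviate_nth)

lemma deviate_in_joint_actions:
  "x \<in> joint_actions A \<Longrightarrow> y \<in> A i \<Longrightarrow> deviate x i y \<in> joint_actions A"
  by (simp add: joint_actions_def deviate_nth)

lemma norm_vec_squared:
  fixes x :: "'a::real_normed_vector ^ 'n::finite"
  shows "(norm x)\<^sup>2 = (\<Sum>i\<in>UNIV. (norm (x $ i))\<^sup>2)"
  by (simp add: norm_vec_def L2_set_def sum_nonneg)

text \<open>Both deviations play \<open>b\<close> at \<open>i\<close>, so the \<open>i\<close>-th
  term of the squared norm drops out. The exact identity, rather than an inequality, is what later
  produces the factor N - 1 instead of N.\<close>

lemma norm_deviate_diff_squared:
  fixes x y :: "'a::real_normed_vector ^ 'n::finite"
  shows "(norm (deviate x i b - deviate y i b))\<^sup>2 = (norm (x - y))\<^sup>2 - (norm (x $ i - y $ i))\<^sup>2"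
proof -
  have "(norm (deviate x i b - deviate y i b))\<^sup>2
      = (\<Sum>j\<in>UNIV - {i}. (norm (x $ j - y $ j))\<^sup>2)"
    unfolding norm_vec_squared by (subst sum.remove[of _ i]) (auto simp: deviate_nth)
  also have "\<dots> = (norm (x - y))\<^sup>2 - (norm (x $ i - y $ i))\<^sup>2"
    unfolding norm_vec_squared by (subst (2) sum.remove[of _ i]) auto
  finally show ?thesis .
qed

lemma norm_deviate_diff_le:
  fixes x y :: "'a::real_normed_vector ^ 'n::finite"
  shows "norm (deviate x i b - deviate y i b) \<le> norm (x - y)"
  by (rule power2_le_imp_le) (simp_all add: norm_deviate_diff_squared)

section \<open>First-order optimality on convex sets\<close>

text \<open>Were the product negative, \<open>f\<close> would decrease at first order along the
  segment from \<open>a\<close> to \<open>y\<close>, which lies in \<open>S\<close>. Since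
  everything happens on this segment, a derivative within \<open>S\<close> suffices even if
  \<open>S\<close> has empty interior.\<close>

lemma minimizer_variational_inequality:
  fixes g :: "'a::real_inner"
  assumes "convex S" and a: "a \<in> S" and y: "y \<in> S"
    and der: "(f has_derivative (\<lambda>h. g \<bullet> h)) (at a within S)"
    and min: "\<And>z. z \<in> S \<Longrightarrow> f a \<le> (f z :: real)"
  shows "g \<bullet> (y - a) \<ge> 0"
proof (rule ccontr)
  assume neg: "\<not> g \<bullet> (y - a) \<ge> 0"
  define p where "p s = a + s *\<^sub>R (y - a)" for s :: real
  have p_in: "p s \<in> S" if "s \<in> {0..1}" for s
  proof -
    have "p s = (1 - s) *\<^sub>R a + s *\<^sub>R y" by (simp add: p_def algebra_simps)
    then show ?thesis using convexD_alt[OF assms(1) a y, of s] that by simp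
  qed
  have "(p has_derivative (\<lambda>s. s *\<^sub>R (y - a))) (at 0 within {0..1})"
    unfolding p_def by (auto intro!: derivative_eq_intros)
  moreover have "(f has_derivative (\<lambda>h. g \<bullet> h)) (at (p 0) within p ` {0..1})"
  proof -
    have "p ` {0..1} \<subseteq> S" using p_in by blast
    from has_derivative_subset[OF der this] show ?thesis by (simp add: p_def)
  qed
  ultimately have "((\<lambda>s. f (p s)) has_derivative (\<lambda>s. g \<bullet> (s *\<^sub>R (y - a)))) (at 0 within {0..1})"
    by (rule has_derivative_in_compose)
  then have "((\<lambda>s. f (p s)) has_real_derivative g \<bullet> (y - a)) (at 0 within {0..1})"
    by (simp add: has_field_derivative_def mult_commute_abs)
  then obtain d where d: "d > 0"
    and dec: "\<And>h. h > 0 \<Longrightarrow> 0 + h \<in> {0..1} \<Longrightarrow> h < d \<Longrightarrow> f (p (0 + h)) < f (p 0)"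
    using has_real_derivative_neg_dec_right[of "\<lambda>s. f (p s)" "g \<bullet> (y - a)" 0 "{0..1}"] neg by auto
  \<comment> \<open>The decrease \<open>dec\<close> is known only for steps shorter than
    \<open>d\<close> that do not leave the segment.\<close>
  define h where "h = min 1 (d / 2)"
  have "h > 0" "h \<in> {0..1}" "h < d" using d by (auto simp: h_def min_def)
  then have "f (p h) < f a" using dec[of h] by (simp add: p_def)
  moreover have "f a \<le> f (p h)" using min p_in \<open>h \<in> {0..1}\<close> by blast
  ultimately show False by simp
qed

lemma partial_gradient_variational_inequality:
  assumes "partial_gradient A i f g" "convex (A i)" "z \<in> joint_actions A" "y \<in> A i"
    and min: "\<And>y. y \<in> A i \<Longrightarrow> f z \<le> f (deviate z i y)"
  shows "g z \<bullet> (y - z $ i) \<ge> 0"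
proof (rule minimizer_variational_inequality[OF assms(2) _ assms(4)])
  show "z $ i \<in> A i" using assms(3) by (simp add: joint_actions_def)
  show "((\<lambda>y. f (deviate z i y)) has_derivative (\<lambda>h. g z \<bullet> h)) (at (z $ i) within A i)"
    using assms(1,3) by (simp add: partial_gradient_def)
qed (simp add: deviate_self min)

section \<open>Contraction of the best response map\<close>

text \<open>If the two joint actions differ only at \<open>i\<close>, only the \<open>i\<close>-th
  summand of the monotonicity inequality survives. Thus each partial gradient is strongly monotone
  in the agent's own action, with the constant of the whole game.\<close>

lemma strongly_monotone_single_agent:
  assumes mono: "strongly_monotone A G m" and z: "z \<in> joint_actions A" and y: "y \<in> A i"
  shows "m * (norm (y - z $ i))\<^sup>2 \<le> (G i (deviate z i y) - G i z) \<bullet> (y - z $ i)"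
proof -
  let ?z = "deviate z i y"
  have "(norm (?z - z))\<^sup>2 = (\<Sum>j\<in>UNIV. if j = i then (norm (y - z $ i))\<^sup>2 else 0)"
    unfolding norm_vec_squared by (intro sum.cong) (auto simp: deviate_nth)
  then have norm: "(norm (?z - z))\<^sup>2 = (norm (y - z $ i))\<^sup>2" by simp
  have "(\<Sum>j\<in>UNIV. (G j ?z - G j z) \<bullet> (?z $ j - z $ j))
      = (\<Sum>j\<in>UNIV. if j = i then (G i ?z - G i z) \<bullet> (y - z $ i) else 0)"
    by (intro sum.cong) (auto simp: deviate_nth)
  then have "(\<Sum>j\<in>UNIV. (G j ?z - G j z) \<bullet> (?z $ j - z $ j)) = (G i ?z - G i z) \<bullet> (y - z $ i)"
    by simp
  moreover have "m * (norm (?z - z))\<^sup>2 \<le> (\<Sum>j\<in>UNIV. (G j ?z - G j z) \<bullet> (?z $ j - z $ j))"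
    using mono z deviate_in_joint_actions[where A = A, OF z y] by (auto simp: strongly_monotone_def)
  ultimately show ?thesis by (simp add: norm)
qed

lemma lipschitz_in_others_deviate:
  assumes "lipschitz_in_others A i K f" "x \<in> joint_actions A" "y \<in> joint_actions A" "b \<in> A i"
  shows "dist (f (deviate x i b)) (f (deviate y i b)) \<le> K * norm (deviate x i b - deviate y i b)"
  using assms unfolding lipschitz_in_others_def
  by (auto simp: deviate_nth deviate_in_joint_actions dist_norm[symmetric]
      intro!: lipschitz_onD[of K "{x \<in> joint_actions A. x $ i = b}"])

lemma lipschitz_in_others_nonneg:
  "lipschitz_in_others A i K f \<Longrightarrow> A i \<noteq> {} \<Longrightarrow> K \<ge> 0"
  unfolding lipschitz_in_others_def by (auto dest: lipschitz_on_nonneg)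

text \<open>For each agent, \<open>deviate z i (b $ i)\<close> is an intermediate point: it is
  compared with \<open>z\<close> by strong monotonicity and with \<open>deviate x i (b $ i)\<close>
  by the Lipschitz bound. The squared estimates are then summed over the agents.\<close>

lemma best_response_contraction:
  fixes A :: "'n::finite \<Rightarrow> 'a::euclidean_space set"
  assumes convex: "\<And>i. convex (A i)"
    and grad: "\<And>i. partial_gradient A i (c i) (G i)"
    and mono: "strongly_monotone A G m"
    and lip: "\<And>i. lipschitz_in_others A i L (G i)"
    and nash: "nash_equilibrium A c z"
    and x: "x \<in> joint_actions A" and b: "b \<in> joint_actions A"
    and best: "\<And>i y. y \<in> A i \<Longrightarrow> c i (deviate x i (b $ i)) \<le> c i (deviate x i y)"
  shows "norm (b - z) \<le> L * sqrt (real CARD('n) - 1) / m * norm (x - z)"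
proof -
  have m: "m > 0" using mono by (simp add: strongly_monotone_def)
  have z: "z \<in> joint_actions A" using nash by (simp add: nash_equilibrium_def)
  have bi: "b $ i \<in> A i" and zi: "z $ i \<in> A i" for i
    using b z by (auto simp: joint_actions_def)
  have L: "L \<ge> 0" using lipschitz_in_others_nonneg[OF lip] bi by blast
  have agent: "(norm (b $ i - z $ i))\<^sup>2
      \<le> (L / m)\<^sup>2 * ((norm (x - z))\<^sup>2 - (norm (x $ i - z $ i))\<^sup>2)" for i
  proof -
    let ?x = "deviate x i (b $ i)" and ?z = "deviate z i (b $ i)" and ?d = "b $ i - z $ i"
    have x': "?x \<in> joint_actions A" using deviate_in_joint_actions[OF x bi] .
    \<comment> \<open>Each minimiser is tested against the other: \<open>b $ i\<close>, optimal
      against the opponents in \<open>x\<close>, and \<open>z $ i\<close>, optimal against those in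
      \<open>z\<close>.\<close>
    have "G i ?x \<bullet> (z $ i - ?x $ i) \<ge> 0"
      by (rule partial_gradient_variational_inequality[OF grad convex x' zi])
        (simp add: deviate_deviate best)
    then have 1: "G i ?x \<bullet> ?d \<le> 0" by (simp add: deviate_nth inner_diff_right)
    have 2: "G i z \<bullet> ?d \<ge> 0"
      using nash by (intro partial_gradient_variational_inequality[OF grad convex z bi])
        (auto simp: nash_equilibrium_def)
    have "m * (norm ?d)\<^sup>2 \<le> (G i ?z - G i z) \<bullet> ?d"
      by (rule strongly_monotone_single_agent[OF mono z bi])
    \<comment> \<open>The signs in \<open>1\<close> and \<open>2\<close> let \<open>G i ?x\<close>
      replace \<open>G i z\<close>. Both remaining points play \<open>b $ i\<close>, so the
      Lipschitz hypothesis applies.\<close>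
    also have "\<dots> \<le> (G i ?z - G i ?x) \<bullet> ?d"
      using 1 2 by (simp add: inner_diff_left)
    also have "\<dots> \<le> norm (G i ?x - G i ?z) * norm ?d"
      using norm_cauchy_schwarz[of "G i ?z - G i ?x" ?d] by (simp add: norm_minus_commute)
    also have "\<dots> \<le> (L * norm (?x - ?z)) * norm ?d"
      using lipschitz_in_others_deviate[OF lip x z bi] by (intro mult_right_mono) (auto simp: dist_norm)
    finally have le: "m * norm ?d * norm ?d \<le> (L * norm (?x - ?z)) * norm ?d"
      by (simp add: power2_eq_square mult.assoc)
    have "m * norm ?d \<le> L * norm (?x - ?z)"
    proof (cases "?d = 0")
      case False
      with le show ?thesis by (metis mult_right_le_imp_le zero_less_norm_iff)
    qed (use L in simp)
    then have "norm ?d \<le> L / m * norm (?x - ?z)" using m by (simp add: field_simps)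
    then have "(norm ?d)\<^sup>2 \<le> (L / m * norm (?x - ?z))\<^sup>2" by (rule power_mono) simp
    then show ?thesis by (simp only: power_mult_distrib norm_deviate_diff_squared)
  qed
  have "(norm (b - z))\<^sup>2 \<le> (\<Sum>i\<in>UNIV. (L / m)\<^sup>2 * ((norm (x - z))\<^sup>2 - (norm (x $ i - z $ i))\<^sup>2))"
    unfolding norm_vec_squared[of "b - z"] using agent by (intro sum_mono) simp
  \<comment> \<open>The subtracted own components add up to one full copy of the squared norm, so N
    copies become N - 1.\<close>
  also have "\<dots> = (L / m)\<^sup>2 * (real CARD('n) * (norm (x - z))\<^sup>2 - (norm (x - z))\<^sup>2)"
    by (simp add: sum_distrib_left[symmetric] sum_subtractf norm_vec_squared[of "x - z"])
  also have "\<dots> = (L / m)\<^sup>2 * (sqrt (real CARD('n) - 1))\<^sup>2 * (norm (x - z))\<^sup>2"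
    using one_le_card_finite[where 'a='n] by (simp add: algebra_simps)
  also have "\<dots> = (L * sqrt (real CARD('n) - 1) / m * norm (x - z))\<^sup>2"
    by (simp add: power_mult_distrib power_divide)
  finally show ?thesis
    by (rule power2_le_imp_le) (use L m one_le_card_finite[where 'a='n] in simp)
qed

section \<open>Summation of tracking errors and of the equilibrium drift\<close>

text \<open>The recursion telescopes. The induction keeps the last error \<open>e (Suc T)\<close> on
  the left, to be dropped at the end by nonnegativity.\<close>

lemma sum_contraction_le:
  fixes e d :: "nat \<Rightarrow> real"
  assumes "r < 1" and nonneg: "\<And>t. e t \<ge> 0"
    and step: "\<And>t. t \<ge> 1 \<Longrightarrow> e (Suc t) \<le> r * e t + d t"
  shows "(1 - r) * (\<Sum>t=1..T. e t) \<le> e 1 + (\<Sum>t=1..T. d t)"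
proof -
  have "(1 - r) * (\<Sum>t=1..T. e t) + e (Suc T) \<le> e 1 + (\<Sum>t=1..T. d t)"
  proof (induction T)
    case (Suc T)
    then show ?case using step[of "Suc T"] by (simp add: algebra_simps)
  qed simp
  then show ?thesis using nonneg[of "Suc T"] by linarith
qed

text \<open>Cauchy-Schwarz against the constant sequence 1; this is where the factor T under the
  root comes from.\<close>

lemma sum_le_sqrt_equilibrium_variation:
  "(\<Sum>t=1..T. norm (xs t - xs (Suc t))) \<le> sqrt (real T * equilibrium_variation xs T)"
proof (rule real_le_rsqrt)
  show "(\<Sum>t=1..T. norm (xs t - xs (Suc t)))\<^sup>2 \<le> real T * equilibrium_variation xs T"
    using sum_squared_le_sum_of_squares[of "\<lambda>t. norm (xs t - xs (Suc t))" "{1..T}"]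
    by (simp add: equilibrium_variation_def mult.commute)
qed

section \<open>The comparison rate and the absorption of additive constants\<close>

lemma function_variation_summand_nonneg:
  assumes "joint_actions A \<noteq> {}"
  shows "0 \<le> (SUP x\<in>joint_actions A. ereal \<bar>C t i x - C (Suc t) i x\<bar>)"
proof -
  obtain z where "z \<in> joint_actions A" using assms by blast
  then show ?thesis by (rule SUP_upper2) simp
qed

lemma regret_rate_nonneg:
  assumes "joint_actions A \<noteq> {}"
  shows "0 \<le> regret_rate A C xs i T"
  unfolding regret_rate_def function_variation_def equilibrium_variation_def
  using function_variation_summand_nonneg[OF assms]
  by (intro add_nonneg_nonneg sum_nonneg) (auto intro!: sum_nonneg mult_nonneg_nonneg)

lemma regret_rate_mono:
  assumes "joint_actions A \<noteq> {}" "S \<le> T"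
  shows "regret_rate A C xs i S \<le> regret_rate A C xs i T"
proof -
  have "function_variation A C i S \<le> function_variation A C i T"
    unfolding function_variation_def
    using assms by (intro sum_mono2 function_variation_summand_nonneg) auto
  moreover have "equilibrium_variation xs S \<le> equilibrium_variation xs T"
    unfolding equilibrium_variation_def using assms by (intro sum_mono2) auto
  then have "real S * equilibrium_variation xs S \<le> real T * equilibrium_variation xs T"
    using assms(2) by (intro mult_mono) (auto simp: equilibrium_variation_def intro!: sum_nonneg)
  ultimately show ?thesis
    unfolding regret_rate_def by (intro add_mono) simp_all
qed

text \<open>Once \<open>g T\<close> is at least \<open>eps\<close>, the additive constant
  \<open>K\<close> is at most \<open>K / eps\<close> times \<open>g T\<close> and joins the
  multiplicative constant.\<close>

lemma bigo_ereal_affine_bound: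
  assumes bound: "\<And>T. ereal \<bar>f T\<bar> \<le> ereal K + ereal c * g T" and "K \<ge> 0" "c > 0" "eps > 0"
    and large: "\<forall>\<^sub>F T in sequentially. ereal eps \<le> g T"
  shows "bigo_ereal f g"
proof -
  have "ereal \<bar>f T\<bar> \<le> ereal (K / eps + c) * g T" if T: "ereal eps \<le> g T" for T
  proof (cases "g T")
    case (real v)
    then have "K * eps \<le> K * v" using T \<open>K \<ge> 0\<close> by (simp add: mult_left_mono)
    then have "K \<le> K / eps * v" using \<open>eps > 0\<close> by (simp add: field_simps)
    then show ?thesis using bound[of T] real by (simp add: algebra_simps)
  next
    case PInf
    have "K / eps + c > 0" using assms by (simp add: add_nonneg_pos)
    then show ?thesis using PInf by simp
  next
    case MInf
    then show ?thesis using T by simp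
  qed
  then have "\<forall>\<^sub>F T in sequentially. ereal \<bar>f T\<bar> \<le> ereal (K / eps + c) * g T"
    using large by (rule eventually_mono[rotated])
  moreover have "K / eps + c > 0" using assms by (simp add: add_nonneg_pos)
  ultimately show ?thesis unfolding bigo_ereal_def by blast
qed

text \<open>The rate is nondecreasing in \<open>T\<close>, so a single nonzero value bounds it away
  from zero from then on.\<close>

lemma bigo_ereal_regret_rate:
  assumes nonempty: "joint_actions A \<noteq> {}"
    and bound: "\<And>T. ereal \<bar>f T\<bar> \<le> ereal K + ereal c * regret_rate A C xs i T"
    and "K \<ge> 0" "c > 0" and nonzero: "regret_rate A C xs i S \<noteq> 0"
  shows "bigo_ereal f (regret_rate A C xs i)"
proof -
  have "0 < regret_rate A C xs i S"
    using nonzero regret_rate_nonneg[OF nonempty, of C xs i S] by (simp add: order_less_le)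
  \<comment> \<open>The rate at \<open>S\<close> may be infinite, hence a real number strictly below
    it.\<close>
  then obtain eps where eps: "0 < ereal eps" "ereal eps < regret_rate A C xs i S"
    using ereal_dense2 by blast
  have "\<forall>\<^sub>F T in sequentially. ereal eps \<le> regret_rate A C xs i T"
    using eventually_ge_at_top[of S]
  proof eventually_elim
    case (elim T)
    then show ?case
      using regret_rate_mono[OF nonempty elim, of C xs i] eps(2) by simp
  qed
  then show ?thesis
    using bigo_ereal_affine_bound[OF bound] assms(3,4) eps(1) by simp
qed

text \<open>The summand 1 itself supplies the lower bound, also when the rate vanishes
  identically.\<close>

lemma bigo_ereal_one_plus_regret_rate:
  assumes nonempty: "joint_actions A \<noteq> {}"
    and bound: "\<And>T. ereal \<bar>f T\<bar> \<le> ereal K + ereal c * regret_rate A C xs i T"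
    and "K \<ge> 0" "c > 0"
  shows "bigo_ereal f (\<lambda>T. 1 + regret_rate A C xs i T)"
proof (rule bigo_ereal_affine_bound[where K = K and c = c and eps = 1])
  fix T
  have "regret_rate A C xs i T \<le> 1 + regret_rate A C xs i T"
    using regret_rate_nonneg[OF nonempty, of C xs i T] by (simp add: ereal_le_add_self2)
  then have "ereal c * regret_rate A C xs i T \<le> ereal c * (1 + regret_rate A C xs i T)"
    using \<open>c > 0\<close> by (intro ereal_mult_left_mono) auto
  then show "ereal \<bar>f T\<bar> \<le> ereal K + ereal c * (1 + regret_rate A C xs i T)"
    using bound[of T] add_left_mono order_trans by blast
next
  show "\<forall>\<^sub>F T in sequentially. ereal 1 \<le> 1 + regret_rate A C xs i T"
    using regret_rate_nonneg[OF nonempty, of C xs i]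
    by (simp add: one_ereal_def[symmetric] ereal_le_add_self)
qed (use assms in auto)

section \<open>Regret estimates for one episode and for their sum\<close>

text \<open>Passage from extended reals to reals: a sum other than \<infinity> has no infinite
  summand, and a nonempty set of joint actions excludes -\<infinity>.\<close>

lemma function_variation_finite:
  assumes nonempty: "joint_actions A \<noteq> {}" and finite: "function_variation A C i T \<noteq> \<infinity>"
  obtains w where "\<And>t z. t \<in> {1..T} \<Longrightarrow> z \<in> joint_actions A \<Longrightarrow> \<bar>C t i z - C (Suc t) i z\<bar> \<le> w t"
    and "function_variation A C i T = ereal (\<Sum>t=1..T. w t)"
proof
  let ?S = "\<lambda>t. SUP x\<in>joint_actions A. ereal \<bar>C t i x - C (Suc t) i x\<bar>"
  have eq: "?S t = ereal (real_of_ereal (?S t))" if "t \<in> {1..T}" for t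
  proof -
    have "?S t \<noteq> \<infinity>" using finite that unfolding function_variation_def sum_Pinfty by blast
    then show ?thesis
      using function_variation_summand_nonneg[OF nonempty, of C t i] by (cases "?S t") auto
  qed
  show "\<bar>C t i z - C (Suc t) i z\<bar> \<le> real_of_ereal (?S t)"
    if t: "t \<in> {1..T}" and z: "z \<in> joint_actions A" for t z
  proof -
    have "ereal \<bar>C t i z - C (Suc t) i z\<bar> \<le> ?S t" using z by (rule SUP_upper)
    then show ?thesis by (subst (asm) eq[OF t]) simp
  qed
  have "function_variation A C i T = (\<Sum>t=1..T. ereal (real_of_ereal (?S t)))"
    unfolding function_variation_def by (intro sum.cong refl eq)
  then show "function_variation A C i T = ereal (\<Sum>t=1..T. real_of_ereal (?S t))" by simp
qed

text \<open>The best response attains the infimum, so the real-valued \<open>INF\<close> is a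
  genuine minimum.\<close>

lemma dynamic_regret_best_response:
  assumes "\<And>t y. t \<ge> 1 \<Longrightarrow> y \<in> A i \<Longrightarrow> C t i (deviate (x t) i (b t)) \<le> C t i (deviate (x t) i y)"
    and "\<And>t. t \<ge> 1 \<Longrightarrow> b t \<in> A i"
  shows "dynamic_regret A C x i T = (\<Sum>t=1..T. C t i (x t) - C t i (deviate (x t) i (b t)))"
proof -
  have "(INF y\<in>A i. C t i (deviate (x t) i y)) = C t i (deviate (x t) i (b t))" if "t \<ge> 1" for t
    using assms that by (intro cInf_eq_minimum) auto
  then show ?thesis unfolding dynamic_regret_def by (intro sum.cong) auto
qed

text \<open>Here \<open>c\<close>, \<open>x\<close> belong to one episode and \<open>c'\<close>,
  \<open>x'\<close> to the next. Exchanging \<open>c'\<close> for \<open>c\<close> costs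
  \<open>w\<close>, and exchanging the opponents in \<open>x'\<close> for those in \<open>x\<close>
  costs \<open>K * norm (x' - x)\<close>; each is paid twice, for the action \<open>x' $ i\<close>
  and for its competitor \<open>y\<close>.\<close>

lemma best_response_regret_le:
  assumes lip: "lipschitz_in_others A i K c"
    and x: "x \<in> joint_actions A" and x': "x' \<in> joint_actions A" and y: "y \<in> A i"
    and best: "c (deviate x i (x' $ i)) \<le> c (deviate x i y)"
    and var: "\<And>z. z \<in> joint_actions A \<Longrightarrow> \<bar>c z - c' z\<bar> \<le> w"
  shows "c' x' - c' (deviate x' i y) \<le> 2 * w + 2 * K * norm (x' - x)"
proof -
  have K: "K \<ge> 0" using lipschitz_in_others_nonneg[OF lip] y by blast
  have swap: "\<bar>c (deviate x' i b) - c (deviate x i b)\<bar> \<le> K * norm (x' - x)" if "b \<in> A i" for b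
    using lipschitz_in_others_deviate[OF lip x' x that]
      mult_left_mono[OF norm_deviate_diff_le[of x' i b x] K] by (simp add: dist_real_def)
  have "x' $ i \<in> A i" using x' by (simp add: joint_actions_def)
  then show ?thesis
    using swap[of "x' $ i"] swap[OF y] best var[OF x']
      var[OF deviate_in_joint_actions[of x' A y i, OF x' y]]
    by (simp add: deviate_self)
qed

lemma dynamic_regret_bound:
  assumes regret_nonneg: "\<And>t. t \<ge> 1 \<Longrightarrow> 0 \<le> reg t"
    and regret_step: "\<And>t. t \<in> {1..T} \<Longrightarrow> reg (Suc t) \<le> 2 * w t + 2 * K * norm (x (Suc t) - x t)"
    and tracking: "\<And>t. t \<ge> 1 \<Longrightarrow> norm (x (Suc t) - xs t) \<le> r * norm (x t - xs t)"
    and "r < 1" "K \<ge> 0"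
  shows "(\<Sum>t=1..T. reg t) \<le> reg 1 + 4 * K * norm (x 1 - xs 1) / (1 - r) + 2 * (\<Sum>t=1..T. w t)
    + (4 * K / (1 - r) + 4 * K) * sqrt (real T * equilibrium_variation xs T)"
proof -
  define e where "e t = norm (x t - xs t)" for t
  define d where "d t = norm (xs t - xs (Suc t))" for t
  define Q where "Q = sqrt (real T * equilibrium_variation xs T)"
  have dQ: "(\<Sum>t=1..T. d t) \<le> Q"
    using sum_le_sqrt_equilibrium_variation unfolding d_def Q_def .
  have e_step: "e (Suc t) \<le> r * e t + d t" if "t \<ge> 1" for t
    using tracking[OF that] norm_triangle_ineq[of "x (Suc t) - xs t" "xs t - xs (Suc t)"]
    by (simp add: e_def d_def)
  have "(1 - r) * (\<Sum>t=1..T. e t) \<le> e 1 + Q"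
    using sum_contraction_le[where e = e, OF \<open>r < 1\<close> _ e_step, of T] dQ by (simp add: e_def)
  then have eQ: "(\<Sum>t=1..T. e t) \<le> (e 1 + Q) / (1 - r)"
    using \<open>r < 1\<close> by (simp add: field_simps)
  have step: "reg (Suc t) \<le> 2 * w t + 4 * K * (e t + d t)" if t: "t \<in> {1..T}" for t
  proof -
    \<comment> \<open>The equilibrium \<open>xs t\<close> is inserted because
      \<open>x (Suc t)\<close>, a response within episode \<open>t\<close>, contracts towards it and
      not towards \<open>xs (Suc t)\<close>.\<close>
    have "norm (x (Suc t) - x t) \<le> norm (x (Suc t) - xs t) + e t"
      using norm_triangle_ineq4[of "x (Suc t) - xs t" "x t - xs t"] by (simp add: e_def)
    also have "\<dots> \<le> r * e t + e t" using tracking[of t] t by (simp add: e_def)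
    also have "\<dots> \<le> 2 * (e t + d t)"
    proof -
      have "r * e t \<le> 1 * e t" using \<open>r < 1\<close> by (intro mult_right_mono) (auto simp: e_def)
      moreover have "d t \<ge> 0" by (simp add: d_def)
      ultimately show ?thesis by simp
    qed
    finally have "2 * K * norm (x (Suc t) - x t) \<le> 2 * K * (2 * (e t + d t))"
      using \<open>K \<ge> 0\<close> by (intro mult_left_mono) auto
    then show ?thesis using regret_step[OF t] by (simp add: algebra_simps)
  qed
  \<comment> \<open>Adding one episode lets the sum split into \<open>reg 1\<close>, which has no
    predecessor and stays as a constant, and \<open>T\<close> shifted terms matching
    \<open>w\<close> on \<open>{1..T}\<close>.\<close>
  have "(\<Sum>t=1..T. reg t) \<le> (\<Sum>t=1..Suc T. reg t)" using regret_nonneg[of "Suc T"] by simp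
  also have "\<dots> = reg 1 + (\<Sum>t=1..T. reg (Suc t))"
    by (induction T) auto
  also have "\<dots> \<le> reg 1 + (\<Sum>t=1..T. 2 * w t + 4 * K * (e t + d t))"
    using step by (intro add_left_mono sum_mono)
  also have "\<dots> = reg 1 + 2 * (\<Sum>t=1..T. w t) + 4 * K * ((\<Sum>t=1..T. e t) + (\<Sum>t=1..T. d t))"
    by (simp add: sum.distrib sum_distrib_left[symmetric] distrib_left)
  also have "\<dots> \<le> reg 1 + 2 * (\<Sum>t=1..T. w t) + 4 * K * ((e 1 + Q) / (1 - r) + Q)"
    using eQ dQ \<open>K \<ge> 0\<close> by (intro add_left_mono mult_left_mono add_mono) auto
  also have "\<dots> = reg 1 + 4 * K * e 1 / (1 - r) + 2 * (\<Sum>t=1..T. w t) + (4 * K / (1 - r) + 4 * K) * Q"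
    by (simp add: algebra_simps add_divide_distrib)
  finally show ?thesis by (simp add: e_def Q_def)
qed

section \<open>Tracking and regret estimates combined\<close>

theorem theorem2:
  fixes A :: "'n::finite \<Rightarrow> 'a::euclidean_space set"
    and C :: "nat \<Rightarrow> 'n \<Rightarrow> 'a ^ 'n \<Rightarrow> real"
    and G :: "nat \<Rightarrow> 'n \<Rightarrow> 'a ^ 'n \<Rightarrow> 'a"
    and m L :: "nat \<Rightarrow> real"
    and L0 :: real
    and x xs :: "nat \<Rightarrow> 'a ^ 'n"
  assumes action_sets: "\<And>i. A i \<noteq> {} \<and> closed (A i) \<and> convex (A i)"
    and convex_costs: "\<And>t i z. \<lbrakk>t \<ge> 1; z \<in> joint_actions A\<rbrakk> \<Longrightarrow>
          convex_on (A i) (\<lambda>y. C t i (deviate z i y))"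
    and gradients: "\<And>t i. t \<ge> 1 \<Longrightarrow> partial_gradient A i (C t i) (G t i)"
    and monotone: "\<And>t. t \<ge> 1 \<Longrightarrow> strongly_monotone A (G t) (m t)"
    and lipschitz_gradients: "\<And>t i. t \<ge> 1 \<Longrightarrow> lipschitz_in_others A i (L t) (G t i)"
    and m_gt_L: "\<And>t. t \<ge> 1 \<Longrightarrow> m t > L t * sqrt (real CARD('n) - 1)"
    and rho_attained: "\<exists>s\<ge>1. \<forall>t\<ge>1.
          L t * sqrt (real CARD('n) - 1) / m t \<le> L s * sqrt (real CARD('n) - 1) / m s"
    and lipschitz_costs: "\<And>t i. t \<ge> 1 \<Longrightarrow> lipschitz_in_others A i L0 (C t i)"
    and equilibria: "\<And>t. t \<ge> 1 \<Longrightarrow> nash_equilibrium A (C t) (xs t)"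
    and initial: "x 1 \<in> joint_actions A"
    and best_response: "\<And>t i. t \<ge> 1 \<Longrightarrow>
          is_arg_min (\<lambda>y. C t i (deviate (x t) i y)) (\<lambda>y. y \<in> A i) (x (Suc t) $ i)"
  shows "\<forall>i. ((\<exists>T\<ge>1. regret_rate A C xs i T \<noteq> 0) \<longrightarrow>
                bigo_ereal (dynamic_regret A C x i) (regret_rate A C xs i)) \<and>
             bigo_ereal (dynamic_regret A C x i) (\<lambda>T. 1 + regret_rate A C xs i T)"
proof
  fix i
  \<comment> \<open>The action played in episode \<open>Suc t\<close> is the minimiser against the
    opponents of episode \<open>t\<close>, so \<open>reg t\<close> is the regret incurred in episode
    \<open>t\<close>.\<close>
  define reg where "reg t = C t i (x t) - C t i (deviate (x t) i (x (Suc t) $ i))" for t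
  have xA: "x (Suc t) $ j \<in> A j" if "t \<ge> 1" for t j
    using best_response[OF that, of j] by (simp add: is_arg_min_def)
  have best: "C t j (deviate (x t) j (x (Suc t) $ j)) \<le> C t j (deviate (x t) j y)"
    if "t \<ge> 1" "y \<in> A j" for t j y
    using best_response[OF that(1), of j] that(2) by (auto simp: is_arg_min_def not_less)
  have joint: "x t \<in> joint_actions A" if "t \<ge> 1" for t
    using that
  proof (induction t rule: nat_induct_at_least)
    case base
    show ?case by (rule initial)
  qed (simp add: joint_actions_def xA)
  have nonempty: "joint_actions A \<noteq> {}" using initial by blast
  have L0: "L0 \<ge> 0"
    using lipschitz_in_others_nonneg[OF lipschitz_costs[of 1 i]] action_sets[of i] by simp
  \<comment> \<open>The attained maximum yields one contraction factor, strictly below 1, for all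
    episodes.\<close>
  obtain s where s: "s \<ge> 1" "\<And>t. t \<ge> 1 \<Longrightarrow>
      L t * sqrt (real CARD('n) - 1) / m t \<le> L s * sqrt (real CARD('n) - 1) / m s"
    using rho_attained by blast
  define r where "r = L s * sqrt (real CARD('n) - 1) / m s"
  have "m s > 0" using monotone[OF s(1)] by (simp add: strongly_monotone_def)
  then have r: "r < 1" using m_gt_L[OF s(1)] by (simp add: r_def)
  have tracking: "norm (x (Suc t) - xs t) \<le> r * norm (x t - xs t)" if t: "t \<ge> 1" for t
  proof -
    have "norm (x (Suc t) - xs t) \<le> L t * sqrt (real CARD('n) - 1) / m t * norm (x t - xs t)"
      using action_sets gradients[OF t] monotone[OF t] lipschitz_gradients[OF t] equilibria[OF t]
        joint[OF t] joint[of "Suc t"] best[OF t]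
      by (intro best_response_contraction[where c = "C t" and A = A and G = "G t"]) auto
    also have "\<dots> \<le> r * norm (x t - xs t)"
      unfolding r_def by (intro mult_right_mono s(2) t) simp
    finally show ?thesis .
  qed
  have regret: "dynamic_regret A C x i T = (\<Sum>t=1..T. reg t)" for T
    unfolding reg_def by (rule dynamic_regret_best_response) (auto intro: best xA)
  have reg_nonneg: "0 \<le> reg t" if "t \<ge> 1" for t
    using best[OF that, of "x t $ i" i] joint[OF that]
    by (simp add: reg_def deviate_self joint_actions_def)
  \<comment> \<open>Constants from \<open>dynamic_regret_bound\<close>, chosen independently of
    \<open>T\<close>. The sum \<open>c\<close> dominates both the coefficient 2 of the function
    variation and that of the square root.\<close>
  define K where "K = reg 1 + 4 * L0 * norm (x 1 - xs 1) / (1 - r)"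
  define c where "c = 2 + (4 * L0 / (1 - r) + 4 * L0)"
  have K: "K \<ge> 0" using reg_nonneg[of 1] L0 r by (simp add: K_def)
  have c: "c > 0" using L0 r by (simp add: c_def add_pos_nonneg)
  have bound: "ereal \<bar>dynamic_regret A C x i T\<bar> \<le> ereal K + ereal c * regret_rate A C xs i T" for T
  proof (cases "function_variation A C i T = \<infinity>")
    case True
    then show ?thesis using c by (simp add: regret_rate_def)
  next
    case False
    obtain w where w: "\<And>t z. t \<in> {1..T} \<Longrightarrow> z \<in> joint_actions A \<Longrightarrow> \<bar>C t i z - C (Suc t) i z\<bar> \<le> w t"
      and W: "function_variation A C i T = ereal (\<Sum>t=1..T. w t)"
      using function_variation_finite[OF nonempty False] by blast
    let ?W = "\<Sum>t=1..T. w t" and ?Q = "sqrt (real T * equilibrium_variation xs T)"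
    have step: "reg (Suc t) \<le> 2 * w t + 2 * L0 * norm (x (Suc t) - x t)" if t: "t \<in> {1..T}" for t
      unfolding reg_def
      using t by (intro best_response_regret_le[where c = "C t i" and A = A, OF lipschitz_costs]
          joint xA best w) auto
    have "?W \<ge> 0"
    proof (rule sum_nonneg)
      fix t assume "t \<in> {1..T}"
      from w[OF this initial] show "0 \<le> w t" by linarith
    qed
    have "?Q \<ge> 0" by (auto simp: equilibrium_variation_def intro!: mult_nonneg_nonneg sum_nonneg)
    have "\<bar>dynamic_regret A C x i T\<bar> = (\<Sum>t=1..T. reg t)"
      unfolding regret using reg_nonneg by (intro abs_of_nonneg sum_nonneg) auto
    also have "\<dots> \<le> K + 2 * ?W + (c - 2) * ?Q"
      using dynamic_regret_bound[where reg = reg, OF reg_nonneg step tracking r L0]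
      by (simp add: K_def c_def)
    also have "\<dots> \<le> K + c * (?W + ?Q)"
    proof -
      have "0 \<le> (c - 2) * ?W" using L0 r \<open>?W \<ge> 0\<close> by (simp add: c_def)
      then have "K + 2 * ?W + (c - 2) * ?Q \<le> K + 2 * ?W + (c - 2) * ?W + (c - 2) * ?Q + 2 * ?Q"
        using \<open>?Q \<ge> 0\<close> by linarith
      then show ?thesis by (simp only: algebra_simps)
    qed
    finally show ?thesis by (simp add: regret_rate_def W)
  qed
  show "((\<exists>T\<ge>1. regret_rate A C xs i T \<noteq> 0) \<longrightarrow>
          bigo_ereal (dynamic_regret A C x i) (regret_rate A C xs i)) \<and>
        bigo_ereal (dynamic_regret A C x i) (\<lambda>T. 1 + regret_rate A C xs i T)"
    using bigo_ereal_regret_rate[OF nonempty bound K c]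
      bigo_ereal_one_plus_regret_rate[OF nonempty bound K c] by blast
qed

end
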